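(* Let $(H;\langle\cdot,\cdot\rangle)$ be a real or complex inner product space, let $a\in H$ be a unit vector, let $n\ge 1$, and let $x_1,\dots,x_n\in H\setminus\{0\}$. Let $\alpha=\min\{\|x_k\|:1\le k\le n\}$, let $p\in(0,\sqrt{\alpha^2+1})$, suppose $\max\{\|x_k-a\|:1\le k\le n\}\le p$, and let $$\beta=\min\left\{\frac{\|x_k\|^2-p^2+1}{2\|x_k\|}:1\le k\le n\right\}.$$ Then $$\sum_{k=1}^n\|x_k\|-\left\|\sum_{k=1}^n x_k\right\|\le\frac{1-\beta}{\beta}\operatorname{Re}\left\langle\sum_{k=1}^n x_k,a\right\rangle.$$ Equality holds if and only if both $$\sum_{k=1}^n\|x_k\|\ge\frac{1-\beta}{\beta}\operatorname{Re}\left\langle\sum_{k=1}^n x_k,a\right\rangle$$ and $$\sum_{k=1}^n x_k=\left(\sum_{k=1}^n\|x_k\|-\frac{1-\beta}{\beta}\operatorname{Re}\left\langle\sum_{k=1}^n x_k,a\right\rangle\right)a.$$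
   Context: $\|x\|=\langle x,x\rangle^{1/2}$ is the norm induced by the inner product; $\operatorname{Re}$ denotes the real part (in the real case $\operatorname{Re}\langle x,y\rangle=\langle x,y\rangle$). *)

theory Defs
  imports "HOL-Analysis.Inner_Product"
begin

text \<open>
  The distribution provides \<^class>\<open>real_inner\<close> but no complex inner product spaces.
  The following classes are their complex counterparts, set up in the same style.
\<close>

class scaleC = scaleR +
  fixes scaleC :: "complex \<Rightarrow> 'a \<Rightarrow> 'a" (infixr "*\<^sub>C" 75)
  assumes scaleR_scaleC: "r *\<^sub>R x = complex_of_real r *\<^sub>C x"

class complex_vector = scaleC + ab_group_add +
  assumes scaleC_add_right: "c *\<^sub>C (x + y) = c *\<^sub>C x + c *\<^sub>C y"
    and scaleC_add_left: "(c + d) *\<^sub>C x = c *\<^sub>C x + d *\<^sub>C x"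
    and scaleC_scaleC: "c *\<^sub>C d *\<^sub>C x = (c * d) *\<^sub>C x"
    and scaleC_one: "1 *\<^sub>C x = x"

subclass (in complex_vector) real_vector
  by unfold_locales
    (simp_all add: scaleR_scaleC scaleC_add_right scaleC_add_left scaleC_scaleC scaleC_one)

text \<open>
  The inner product is linear in the first and conjugate-linear in the second argument.
  Conjugate symmetry makes \<^term>\<open>cinner x x\<close> real, so positivity is stated for its real part.
  The norm is the one induced by the inner product; the axioms inherited from
  \<^class>\<open>real_normed_vector\<close> are thus redundant (Cauchy--Schwarz) and only serve to provide the
  library's norm, metric and topology.
\<close>

class complex_inner = complex_vector + real_normed_vector +
  fixes cinner :: "'a \<Rightarrow> 'a \<Rightarrow> complex"
  assumes cinner_commute: "cinner x y = cnj (cinner y x)"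
    and cinner_add_left: "cinner (x + y) z = cinner x z + cinner y z"
    and cinner_scaleC_left: "cinner (c *\<^sub>C x) y = c * cinner x y"
    and cinner_ge_zero: "0 \<le> Re (cinner x x)"
    and cinner_eq_zero_iff: "cinner x x = 0 \<longleftrightarrow> x = 0"
    and norm_eq_sqrt_cinner: "norm x = sqrt (Re (cinner x x))"

instantiation complex :: complex_inner
begin

definition scaleC_complex_def: "c *\<^sub>C (z :: complex) = c * z"

definition cinner_complex_def: "cinner (w :: complex) z = w * cnj z"

instance
proof
  fix r :: real and c d x y z :: complex
  show "r *\<^sub>R x = complex_of_real r *\<^sub>C x"
    by (simp add: scaleC_complex_def scaleR_conv_of_real)
  show "norm x = sqrt (Re (cinner x x))"
    by (simp add: cinner_complex_def cmod_def power2_eq_square)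
qed (simp_all add: scaleC_complex_def cinner_complex_def algebra_simps)

end

end

theory Submission
  imports Defs
begin

text \<open>
  Expanding \<open>\<parallel>x\<^sub>k - a\<parallel>\<^sup>2 \<le> p\<^sup>2\<close> gives \<open>Re \<langle>x\<^sub>k, a\<rangle> \<ge> \<beta> \<parallel>x\<^sub>k\<parallel>\<close>. Writing \<open>s\<close> for the sum of the
  vectors and \<open>r = Re \<langle>s, a\<rangle>\<close>, summation yields \<open>\<Sum>\<parallel>x\<^sub>k\<parallel> \<le> r / \<beta>\<close>; subtracting Cauchy--Schwarz,
  \<open>r \<le> \<parallel>s\<parallel>\<close>, proves the inequality. Equality forces \<open>\<parallel>s\<parallel> = r\<close>, and then
  \<open>\<parallel>s - r a\<parallel>\<^sup>2 = \<parallel>s\<parallel>\<^sup>2 - r\<^sup>2 = 0\<close>.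
\<close>

text \<open>
  The functional \<open>f\<close> stands for \<open>Re \<langle>\<cdot>, a\<rangle>\<close>, which treats the real and the complex case at once.
\<close>

lemma reverse_triangle_functional:
  fixes a :: "'v :: real_normed_vector" and x :: "'i \<Rightarrow> 'v" and f :: "'v \<Rightarrow> real" and p \<beta> :: real
  assumes "additive f"
    and expand: "\<And>y r. (norm (y - r *\<^sub>R a))\<^sup>2 = (norm y)\<^sup>2 - 2 * r * f y + r\<^sup>2"
    and I: "finite I" "I \<noteq> {}"
    and nz: "\<forall>k\<in>I. x k \<noteq> 0"
    and p: "0 < p" "p < sqrt ((Min ((\<lambda>k. norm (x k)) ` I))\<^sup>2 + 1)"
    and Max_le: "Max ((\<lambda>k. norm (x k - a)) ` I) \<le> p"
    and \<beta>: "\<beta> = Min ((\<lambda>k. ((norm (x k))\<^sup>2 - p\<^sup>2 + 1) / (2 * norm (x k))) ` I)"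
  defines "s \<equiv> \<Sum>k\<in>I. x k" and "N \<equiv> \<Sum>k\<in>I. norm (x k)" and "c \<equiv> (1 - \<beta>) / \<beta>"
  shows "N - norm s \<le> c * f s \<and>
    (N - norm s = c * f s \<longleftrightarrow> N \<ge> c * f s \<and> s = (N - c * f s) *\<^sub>R a)"
proof -
  interpret f: additive f by fact
  \<comment> \<open>At \<open>y = 0\<close> and \<open>r = 1\<close> the identity
    \<open>expand\<close> reads \<open>(norm a)^2 = 1\<close>, so it encodes that \<open>a\<close>
    is a unit vector.\<close>
  have norm_a: "norm a = 1"
    using expand[of 0 1] by (simp add: f.zero power2_eq_1_iff) (use norm_ge_zero[of a] in linarith)
  \<comment> \<open>Cauchy-Schwarz: \<open>r = f y\<close> minimises the right side of
    \<open>expand\<close>, leaving \<open>0 \<le> (norm y)^2 - (f y)^2\<close>.\<close>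
  have f_le: "f y \<le> norm y" for y
    using expand[of y "f y"] zero_le_power2[of "norm (y - f y *\<^sub>R a)"]
    by (intro power2_le_imp_le[OF _ norm_ge_zero]) (simp add: power2_eq_square)
  have Min_nonneg: "0 \<le> Min ((\<lambda>k. norm (x k)) ` I)"
    using I by simp
  have p2: "p\<^sup>2 < (Min ((\<lambda>k. norm (x k)) ` I))\<^sup>2 + 1"
    using power_strict_mono[OF p(2), of 2] p(1) by simp
  \<comment> \<open>The bound on \<open>p\<close> forces \<open>p^2 < (norm (x k))^2 + 1\<close>.
    Positivity of all ratios passes to their minimum \<open>\<beta>\<close>.\<close>
  have ratio_pos: "0 < ((norm (x k))\<^sup>2 - p\<^sup>2 + 1) / (2 * norm (x k))" if "k \<in> I" for k
  proof -
    have "(Min ((\<lambda>k. norm (x k)) ` I))\<^sup>2 \<le> (norm (x k))\<^sup>2"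
      using I that Min_nonneg by (intro power_mono) auto
    with p2 nz that show ?thesis by simp
  qed
  have \<beta>_pos: "0 < \<beta>"
    using I ratio_pos by (simp add: \<beta>)
  have "\<beta> * norm (x k) \<le> f (x k)" if k: "k \<in> I" for k
  proof -
    have "\<beta> \<le> ((norm (x k))\<^sup>2 - p\<^sup>2 + 1) / (2 * norm (x k))"
      using I k by (simp add: \<beta>)
    then have "2 * (\<beta> * norm (x k)) \<le> (norm (x k))\<^sup>2 - p\<^sup>2 + 1"
      using nz k by (simp add: pos_le_divide_eq mult.assoc mult.left_commute)
    moreover have "norm (x k - a) \<le> p"
      using Max_le I k by simp
    then have "(norm (x k - a))\<^sup>2 \<le> p\<^sup>2"
      by (intro power_mono) simp_all
    ultimately show ?thesis
      using expand[of "x k" 1] by simp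
  qed
  then have "\<beta> * N \<le> f s"
    by (simp add: N_def s_def f.sum sum_distrib_left sum_mono)
  \<comment> \<open>Division by \<open>\<beta>\<close> suffices, because
    \<open>1 + c = 1 / \<beta>\<close>.\<close>
  then have N_le: "N \<le> f s + c * f s"
    using \<beta>_pos by (simp add: c_def field_simps)
  have ineq: "N - norm s \<le> c * f s"
    using N_le f_le[of s] by linarith
  moreover have "N \<ge> c * f s \<and> s = (N - c * f s) *\<^sub>R a" if eq: "N - norm s = c * f s"
  proof -
    \<comment> \<open>Equality turns \<open>N_le\<close> into \<open>norm s \<le> f s\<close>, the
      reverse of \<open>f_le\<close>.\<close>
    have "norm s = f s"
      using N_le f_le[of s] eq by linarith
    then have "(norm (s - f s *\<^sub>R a))\<^sup>2 = 0"
      unfolding expand by (simp add: power2_eq_square)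
    then have "s = f s *\<^sub>R a" by simp
    moreover have "N - c * f s = f s"
      using eq \<open>norm s = f s\<close> by linarith
    moreover have "0 \<le> f s"
      using \<open>norm s = f s\<close> norm_ge_zero[of s] by linarith
    ultimately show ?thesis by simp
  qed
  moreover have "N - norm s = c * f s" if "N \<ge> c * f s" and s: "s = (N - c * f s) *\<^sub>R a"
  proof -
    \<comment> \<open>The vector equation fixes \<open>norm s\<close> only up to this absolute
      value; the condition \<open>N \<ge> c * f s\<close> removes it.\<close>
    have "norm s = \<bar>N - c * f s\<bar>"
      using arg_cong[OF s, of norm] norm_a by simp
    with that(1) show ?thesis by simp
  qed
  ultimately show ?thesis by blast
qed

text \<open>Provides \<open>expand\<close> in the real case, with \<open>f\<close> the inner product
  against \<open>a\<close>.\<close>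

lemma norm_diff_scaleR_inner:
  fixes a y :: "'v :: real_inner"
  assumes "norm a = 1"
  shows "(norm (y - r *\<^sub>R a))\<^sup>2 = (norm y)\<^sup>2 - 2 * r * inner y a + r\<^sup>2"
proof -
  have "inner a a = 1"
    using assms by (simp add: norm_eq_sqrt_inner)
  then show ?thesis
    unfolding power2_norm_eq_inner
    by (simp add: inner_commute[of a y] power2_eq_square algebra_simps)
qed

lemma norm_diff_scaleR_cinner:
  fixes a y :: "'v :: complex_inner"
  assumes "norm a = 1"
  shows "(norm (y - r *\<^sub>R a))\<^sup>2 = (norm y)\<^sup>2 - 2 * r * Re (cinner y a) + r\<^sup>2"
proof -
  have norm2: "(norm z)\<^sup>2 = Re (cinner z z)" for z :: 'v
    by (simp add: norm_eq_sqrt_cinner cinner_ge_zero)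
  have Re_commute: "Re (cinner u v) = Re (cinner v u)" for u v :: 'v
    by (subst cinner_commute) simp
  \<comment> \<open>Additivity is applied to the splitting
    \<open>y = (y - r *\<^sub>R a) + r *\<^sub>R a\<close>.\<close>
  have expand_left: "Re (cinner (y - r *\<^sub>R a) w) = Re (cinner y w) - r * Re (cinner a w)" for w
    using cinner_add_left[of "y - r *\<^sub>R a" "r *\<^sub>R a" w]
    by (simp add: scaleR_scaleC cinner_scaleC_left)
  have "Re (cinner a a) = 1"
    using assms norm2[of a] by simp
  then show ?thesis
    \<comment> \<open>Symmetry of the real part swaps the arguments, so \<open>expand_left\<close>
      also expands the second one.\<close>
    unfolding norm2 expand_left Re_commute[of y "y - r *\<^sub>R a"]
      Re_commute[of a "y - r *\<^sub>R a"] Re_commute[of a y]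
    by (simp add: power2_eq_square algebra_simps)
qed

theorem theorem2p8:
  fixes n :: nat and p :: real
  assumes "n \<ge> 1"
  shows
    "(\<forall>(a :: 'a :: real_inner) (x :: nat \<Rightarrow> 'a) (\<alpha> :: real) (\<beta> :: real).
        norm a = 1 \<and>
        (\<forall>k\<in>{1..n}. x k \<noteq> 0) \<and>
        \<alpha> = Min ((\<lambda>k. norm (x k)) ` {1..n}) \<and>
        0 < p \<and> p < sqrt (\<alpha>\<^sup>2 + 1) \<and>
        Max ((\<lambda>k. norm (x k - a)) ` {1..n}) \<le> p \<and>
        \<beta> = Min ((\<lambda>k. ((norm (x k))\<^sup>2 - p\<^sup>2 + 1) / (2 * norm (x k))) ` {1..n})
        \<longrightarrow>
        (\<Sum>k=1..n. norm (x k)) - norm (\<Sum>k=1..n. x k)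
          \<le> (1 - \<beta>) / \<beta> * inner (\<Sum>k=1..n. x k) a \<and>
        ((\<Sum>k=1..n. norm (x k)) - norm (\<Sum>k=1..n. x k)
            = (1 - \<beta>) / \<beta> * inner (\<Sum>k=1..n. x k) a
          \<longleftrightarrow>
          (\<Sum>k=1..n. norm (x k)) \<ge> (1 - \<beta>) / \<beta> * inner (\<Sum>k=1..n. x k) a \<and>
          (\<Sum>k=1..n. x k)
            = ((\<Sum>k=1..n. norm (x k)) - (1 - \<beta>) / \<beta> * inner (\<Sum>k=1..n. x k) a) *\<^sub>R a))
     \<and>
     (\<forall>(a :: 'b :: complex_inner) (x :: nat \<Rightarrow> 'b) (\<alpha> :: real) (\<beta> :: real).
        norm a = 1 \<and>
        (\<forall>k\<in>{1..n}. x k \<noteq> 0) \<and>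
        \<alpha> = Min ((\<lambda>k. norm (x k)) ` {1..n}) \<and>
        0 < p \<and> p < sqrt (\<alpha>\<^sup>2 + 1) \<and>
        Max ((\<lambda>k. norm (x k - a)) ` {1..n}) \<le> p \<and>
        \<beta> = Min ((\<lambda>k. ((norm (x k))\<^sup>2 - p\<^sup>2 + 1) / (2 * norm (x k))) ` {1..n})
        \<longrightarrow>
        (\<Sum>k=1..n. norm (x k)) - norm (\<Sum>k=1..n. x k)
          \<le> (1 - \<beta>) / \<beta> * Re (cinner (\<Sum>k=1..n. x k) a) \<and>
        ((\<Sum>k=1..n. norm (x k)) - norm (\<Sum>k=1..n. x k)
            = (1 - \<beta>) / \<beta> * Re (cinner (\<Sum>k=1..n. x k) a)
          \<longleftrightarrow>
          (\<Sum>k=1..n. norm (x k)) \<ge> (1 - \<beta>) / \<beta> * Re (cinner (\<Sum>k=1..n. x k) a) \<and>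
          (\<Sum>k=1..n. x k)
            = complex_of_real ((\<Sum>k=1..n. norm (x k))
                - (1 - \<beta>) / \<beta> * Re (cinner (\<Sum>k=1..n. x k) a)) *\<^sub>C a))"
proof -
  have I: "finite {1..n}" "{1..n} \<noteq> {}"
    using assms by auto
  have additive_inner: "additive (\<lambda>y. inner y a)" for a :: 'a
    by (simp add: additive_def inner_add_left)
  have additive_cinner: "additive (\<lambda>y. Re (cinner y a))" for a :: 'b
    by (simp add: additive_def cinner_add_left)
  show ?thesis
    \<comment> \<open>Complex scaling by a real number becomes real scaling, so both halves match
      \<open>reverse_triangle_functional\<close>.\<close>
    unfolding scaleR_scaleC[symmetric]
    by (rule conjI; intro allI impI; elim conjE; hypsubst)
      (rule reverse_triangle_functional[OF additive_inner norm_diff_scaleR_inner I]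
          reverse_triangle_functional[OF additive_cinner norm_diff_scaleR_cinner I];
        (assumption | rule refl))+
qed

end
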